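(* Let $X, Y$ be Banach lattices, where $X$ is reflexive and $Y$ has order continuous norm. Then in the ordered Banach space $\mathcal{K}(X;Y)$ of all compact linear operators from $X$ to $Y$ every increasing order bounded sequence is norm convergent (with respect to the operator norm).
   Context: A Banach lattice $Y$ has order continuous norm if every increasing net in $Y$ which has a supremum converges in norm (to the supremum). $\mathcal{K}(X;Y)$ carries the operator norm and the cone of positive compact operators, where a linear operator $T: X \to Y$ is positive if $TX_+ \subseteq Y_+$ (with $X_+$, $Y_+$ the positive cones of the Banach lattices); thus $S \le T$ means that $T - S$ is positive. A sequence $(T_n)$ in $\mathcal{K}(X;Y)$ is increasing if $T_n \le T_m$ whenever $n \le m$, and order bounded if there exist $R, S \in \mathcal{K}(X;Y)$ with $R \le T_n \le S$ for all $n$. *)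

theory Defs
  imports "HOL-Analysis.Analysis" "HOL-Library.Lattice_Algebras" "HOL-Library.Lub_Glb"
begin

section \<open>Banach lattices\<close>

class banach_lattice = banach + ordered_real_vector + lattice_ab_group_add_abs +
  assumes norm_mono_abs: "\<bar>x\<bar> \<le> \<bar>y\<bar> \<Longrightarrow> norm x \<le> norm y"

instance real :: banach_lattice
  by standard simp

section \<open>Reflexivity\<close>

definition canonical_embedding ::
    "'a::real_normed_vector \<Rightarrow> (('a \<Rightarrow>\<^sub>L real) \<Rightarrow>\<^sub>L real)"
  where "canonical_embedding x = Blinfun (\<lambda>f. blinfun_apply f x)"

lemma canonical_embedding_apply [simp]:
  "blinfun_apply (canonical_embedding x) f = blinfun_apply f x"
  unfolding canonical_embedding_def
  by (subst bounded_linear_Blinfun_apply) (auto intro: blinfun.bounded_linear_left)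

definition reflexive_space :: "'a::banach itself \<Rightarrow> bool"
  where "reflexive_space _ \<longleftrightarrow> surj (canonical_embedding :: 'a \<Rightarrow> _)"

section \<open>Order continuous norm\<close>

definition directed_preorder :: "'i set \<Rightarrow> ('i \<Rightarrow> 'i \<Rightarrow> bool) \<Rightarrow> bool"
  where "directed_preorder I r \<longleftrightarrow>
    I \<noteq> {} \<and> (\<forall>i\<in>I. r i i) \<and>
    (\<forall>i\<in>I. \<forall>j\<in>I. \<forall>k\<in>I. r i j \<longrightarrow> r j k \<longrightarrow> r i k) \<and>
    (\<forall>i\<in>I. \<forall>j\<in>I. \<exists>k\<in>I. r i k \<and> r j k)"

definition net_filter :: "'i set \<Rightarrow> ('i \<Rightarrow> 'i \<Rightarrow> bool) \<Rightarrow> 'i filter"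
  where "net_filter I r = (INF i\<in>I. principal {j\<in>I. r i j})"

text \<open>
  A definition cannot quantify over index types, so the index sets range over the subsets
  of the space itself, with arbitrary directed preorders. No nets are lost: an increasing net
  can be re-indexed by its range, see \<open>order_continuous_norm_net\<close> below.
\<close>

definition order_continuous_norm :: "'b::banach_lattice itself \<Rightarrow> bool"
  where "order_continuous_norm _ \<longleftrightarrow>
    (\<forall>(I :: 'b set) r (y :: 'b \<Rightarrow> 'b) s.
      directed_preorder I r \<longrightarrow> monotone_on I r (\<le>) y \<longrightarrow> isLub UNIV (y ` I) s \<longrightarrow>
      (y \<longlongrightarrow> s) (net_filter I r))"

lemma eventually_net_filter:
  assumes "directed_preorder I r"
  shows "eventually P (net_filter I r) \<longleftrightarrow> (\<exists>i\<in>I. \<forall>j\<in>I. r i j \<longrightarrow> P j)"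
proof -
  have "\<exists>x\<in>I. {j \<in> I. r x j} \<subseteq> {j \<in> I. r a j} \<inter> {j \<in> I. r b j}"
    if ab: "a \<in> I" "b \<in> I" for a b
  proof -
    obtain k where "k \<in> I" "r a k" "r b k"
      using assms ab unfolding directed_preorder_def by blast
    moreover have "r a j \<and> r b j" if "j \<in> I" "r k j" for j
      using assms ab that calculation unfolding directed_preorder_def by metis
    ultimately show ?thesis by blast
  qed
  moreover have "I \<noteq> {}" using assms by (simp add: directed_preorder_def)
  ultimately have "eventually P (net_filter I r) \<longleftrightarrow>
      (\<exists>i\<in>I. eventually P (principal {j \<in> I. r i j}))"
    unfolding net_filter_def by (intro eventually_INF_base) simp_all
  then show ?thesis
    by (simp add: eventually_principal Ball_def imp_conjL)
qed

lemma order_continuous_norm_net: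
  fixes I :: "'i set" and y :: "'i \<Rightarrow> 'b::banach_lattice"
  assumes "order_continuous_norm TYPE('b)"
    and dir: "directed_preorder I r" and mono: "monotone_on I r (\<le>) y"
    and lub: "isLub UNIV (y ` I) s"
  shows "(y \<longlongrightarrow> s) (net_filter I r)"
proof -
  have dir': "directed_preorder (y ` I) (\<le>)"
    unfolding directed_preorder_def
  proof (intro conjI ballI impI)
    show "y ` I \<noteq> {}" using dir by (auto simp: directed_preorder_def)
    fix a b assume "a \<in> y ` I" "b \<in> y ` I"
    then obtain i j where ij: "i \<in> I" "j \<in> I" "a = y i" "b = y j" by blast
    then obtain k where k: "k \<in> I" "r i k" "r j k"
      using dir unfolding directed_preorder_def by blast
    have "a \<le> y k" "b \<le> y k"
      using monotone_onD[OF mono] ij k by auto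
    then show "\<exists>k\<in>y ` I. a \<le> k \<and> b \<le> k"
      using k by blast
  qed auto
  have lim: "((\<lambda>z. z) \<longlongrightarrow> s) (net_filter (y ` I) (\<le>))"
    using assms(1) dir' lub unfolding order_continuous_norm_def
    by (simp add: monotone_on_def)
  show ?thesis
  proof (rule topological_tendstoI)
    fix S assume "open S" "s \<in> S"
    then have "eventually (\<lambda>z. z \<in> S) (net_filter (y ` I) (\<le>))"
      using lim by (auto dest: topological_tendstoD)
    then obtain i where "i \<in> I" "\<forall>j\<in>I. y i \<le> y j \<longrightarrow> y j \<in> S"
      unfolding eventually_net_filter[OF dir'] by blast
    moreover have "y i \<le> y j" if "j \<in> I" "r i j" for j
      using monotone_onD[OF mono \<open>i \<in> I\<close> that] .
    ultimately show "eventually (\<lambda>i. y i \<in> S) (net_filter I r)"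
      unfolding eventually_net_filter[OF dir] by blast
  qed
qed

section \<open>The ordered space of compact operators\<close>

text \<open>
  Compact linear operators are bounded, so nothing is lost by taking them inside the type of
  bounded linear operators, whose norm is the operator norm.
\<close>

definition compact_operators :: "('a::real_normed_vector \<Rightarrow>\<^sub>L 'b::real_normed_vector) set"
  where "compact_operators = {T. compact (closure (blinfun_apply T ` cball 0 1))}"

definition positive_operator :: "('a::banach_lattice \<Rightarrow>\<^sub>L 'b::banach_lattice) \<Rightarrow> bool"
  where "positive_operator T \<longleftrightarrow> (\<forall>x\<ge>0. blinfun_apply T x \<ge> 0)"

definition operator_le ::
    "('a::banach_lattice \<Rightarrow>\<^sub>L 'b::banach_lattice) \<Rightarrow> ('a \<Rightarrow>\<^sub>L 'b) \<Rightarrow> bool"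
  where "operator_le S T \<longleftrightarrow> positive_operator (T - S)"

end

theory Submission
  imports Defs
begin

text \<open>
  It suffices that \<open>T\<close> is Cauchy in operator norm: then it has a norm limit, and norm limits of
  compact operators are compact.

  Suppose it is not Cauchy. Then for some \<open>e > 0\<close> there are positive differences
  \<open>D N = T (m N) - T N\<close> with \<open>N \<le> m N\<close> and positive \<open>x N\<close> in the unit ball such that
  \<open>norm (D N (x N)) > e / 2\<close>. If \<open>R \<le> T n \<le> S\<close>, then \<open>D N \<le> S - R\<close>, and compactness of \<open>R\<close> and
  \<open>S\<close> gives one \<open>u \<ge> 0\<close> such that \<open>D N (x N) \<le> u + v\<close> for all \<open>N\<close>, with \<open>v\<close> of small norm
  (\<open>compact_operator_almost_order_bounded\<close>). So up to a small error \<open>D N (x N)\<close> may be replaced by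
  \<open>y N = inf (D N (x N)) u\<close>, a sequence in the order interval from \<open>0\<close> to \<open>u\<close>.

  Reflexivity makes \<open>y\<close> weakly null. For a positive functional \<open>\<phi>\<close> on the codomain, the functionals
  \<open>\<phi> \<circ> T n\<close> increase and lie below \<open>\<phi> \<circ> S\<close>. By a Dini argument on the weakly compact unit
  ball of the domain such a sequence is norm Cauchy (\<open>increasing_functionals_Cauchy\<close>). Hence
  \<open>\<phi> \<circ> D N\<close> tends to \<open>0\<close> in norm, and \<open>0 \<le> \<phi> (y N) \<le> norm (\<phi> \<circ> D N)\<close>.

  Order continuity of the norm finishes the proof: a positive, order bounded, weakly null sequence
  is not bounded away from \<open>0\<close> in norm (\<open>order_bounded_weakly_null\<close>). Otherwise one passes to terms
  \<open>v j\<close> of the sequence on which countably many functionals decay geometrically. Bounded monotone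
  sequences are norm Cauchy, so the suprema of the tails of \<open>v\<close> exist as norm limits, and they form
  a decreasing Cauchy sequence bounded away from \<open>0\<close>. By the decay each of the functionals tends
  to \<open>0\<close> along it, although one of them norms a finite supremum close to all late members.
  The functionals come from the Hahn-Banach theorem (\<open>positive_norming_functional\<close>).
\<close>

section \<open>The Hahn-Banach theorem for sublinear functionals\<close>

text \<open>
  Homogeneity is required only as an inequality, which makes it easy to check for infima; equality
  follows by rescaling, see \<open>sublinear_scaleR\<close>.
\<close>

definition sublinear :: "('v::real_vector \<Rightarrow> real) \<Rightarrow> bool"
  where "sublinear q \<longleftrightarrow>
    (\<forall>x y. q (x + y) \<le> q x + q y) \<and> (\<forall>c>0. \<forall>x. q (c *\<^sub>R x) \<le> c * q x)"

lemma sublinear_add: "sublinear q \<Longrightarrow> q (x + y) \<le> q x + q y"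
  and sublinear_scaleR_le: "sublinear q \<Longrightarrow> c > 0 \<Longrightarrow> q (c *\<^sub>R x) \<le> c * q x"
  by (simp_all add: sublinear_def)

lemma sublinear_scaleR:
  assumes "sublinear q" "c > 0"
  shows "q (c *\<^sub>R x) = c * q x"
proof (rule antisym)
  have "q ((1 / c) *\<^sub>R c *\<^sub>R x) \<le> (1 / c) * q (c *\<^sub>R x)"
    using assms by (intro sublinear_scaleR_le) auto
  then show "c * q x \<le> q (c *\<^sub>R x)"
    using assms(2) by (simp add: field_simps)
qed (use assms in \<open>rule sublinear_scaleR_le\<close>)

lemma sublinear_0: "sublinear q \<Longrightarrow> q 0 = 0"
  using sublinear_scaleR[of q 2 0] by simp

lemma sublinear_minus: "sublinear q \<Longrightarrow> - q (- x) \<le> q x"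
  using sublinear_add[of q x "- x"] sublinear_0[of q] by simp

text \<open>
  For sublinear \<open>q\<close>, the largest sublinear functional below \<open>q\<close> whose value at \<open>- a\<close> is at most
  \<open>- q a\<close>. It is used twice: a linear functional below \<open>tilt p v\<close> agrees with \<open>p\<close> at \<open>v\<close>, and a
  minimal sublinear functional equals all its tilts, which makes it additive.
\<close>

definition tilt :: "('v::real_vector \<Rightarrow> real) \<Rightarrow> 'v \<Rightarrow> 'v \<Rightarrow> real"
  where "tilt q a x = (INF t\<in>{0..}. q (x + t *\<^sub>R a) - t * q a)"

lemma tilt_bdd_below:
  assumes "sublinear q"
  shows "bdd_below ((\<lambda>t. q (x + t *\<^sub>R a) - t * q a) ` {0..})"
proof (rule bdd_belowI2)
  fix t :: real assume t: "t \<in> {0..}"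
  have "t * q a = q (t *\<^sub>R a)"
    using t sublinear_scaleR[OF assms, of t a] sublinear_0[OF assms] by (cases "t = 0") auto
  also have "\<dots> \<le> q (x + t *\<^sub>R a) + q (- x)"
    using sublinear_add[OF assms, of "x + t *\<^sub>R a" "- x"] by simp
  finally show "- q (- x) \<le> q (x + t *\<^sub>R a) - t * q a" by simp
qed

lemma tilt_le:
  assumes "sublinear q" "t \<ge> 0"
  shows "tilt q a x \<le> q (x + t *\<^sub>R a) - t * q a"
  unfolding tilt_def using assms by (intro cINF_lower tilt_bdd_below) auto

lemma le_tilt: "(\<And>t. t \<ge> 0 \<Longrightarrow> m \<le> q (x + t *\<^sub>R a) - t * q a) \<Longrightarrow> m \<le> tilt q a x"
  unfolding tilt_def by (intro cINF_greatest) auto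

lemma sublinear_tilt:
  assumes q: "sublinear q"
  shows "sublinear (tilt q a)"
  unfolding sublinear_def
proof (intro conjI allI impI)
  fix x y
  have *: "tilt q a (x + y) \<le> (q (x + s *\<^sub>R a) - s * q a) + (q (y + t *\<^sub>R a) - t * q a)"
    if "s \<ge> 0" "t \<ge> 0" for s t
    using tilt_le[OF q, of "s + t" a "x + y"] that
      sublinear_add[OF q, of "x + s *\<^sub>R a" "y + t *\<^sub>R a"]
    by (simp add: algebra_simps)
  have "tilt q a (x + y) - (q (x + s *\<^sub>R a) - s * q a) \<le> tilt q a y" if "s \<ge> 0" for s
  proof (rule le_tilt)
    show "tilt q a (x + y) - (q (x + s *\<^sub>R a) - s * q a) \<le> q (y + t *\<^sub>R a) - t * q a"
      if "t \<ge> 0" for t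
      using *[OF \<open>s \<ge> 0\<close> that] by linarith
  qed
  then have "tilt q a (x + y) - tilt q a y \<le> tilt q a x"
    by (intro le_tilt) (simp add: algebra_simps)
  then show "tilt q a (x + y) \<le> tilt q a x + tilt q a y"
    by simp
next
  fix c :: real and x assume c: "c > 0"
  have "tilt q a (c *\<^sub>R x) / c \<le> q (x + t *\<^sub>R a) - t * q a" if "t \<ge> 0" for t
    using tilt_le[OF q, of "c * t" a "c *\<^sub>R x"] that c
      sublinear_scaleR[OF q c, of "x + t *\<^sub>R a"]
    by (simp add: field_simps)
  then have "tilt q a (c *\<^sub>R x) / c \<le> tilt q a x"
    by (rule le_tilt)
  then show "tilt q a (c *\<^sub>R x) \<le> c * tilt q a x"
    using c by (simp add: field_simps)
qed

text \<open>
  By Zorn's lemma, as the pointwise infimum of a chain of sublinear functionals below \<open>p\<close> is sublinear;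
  the lower bound \<open>- p (- x)\<close> at \<open>x\<close> makes the infimum finite.
\<close>

lemma minimal_sublinear_exists:
  assumes p: "sublinear p"
  obtains f where "sublinear f" "f \<le> p" "\<And>g. sublinear g \<Longrightarrow> g \<le> f \<Longrightarrow> g = f"
proof -
  define A where "A = {q. sublinear q \<and> q \<le> p}"
  have "\<exists>m\<in>A. \<forall>a\<in>A. a \<le> m \<longrightarrow> a = m"
  proof (rule predicate_Zorn)
    show "partial_order_on A (relation_of (\<lambda>x y. y \<le> x) A)"
      by (rule partial_order_on_relation_ofI) auto
  next
    fix C assume C: "C \<in> Chains (relation_of (\<lambda>x y. y \<le> x) A)"
    then have CA: "C \<subseteq> A" and chain: "\<And>q r. q \<in> C \<Longrightarrow> r \<in> C \<Longrightarrow> q \<le> r \<or> r \<le> q"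
      unfolding Chains_def relation_of_def by auto
    show "\<exists>u\<in>A. \<forall>a\<in>C. u \<le> a"
    proof (cases "C = {}")
      case True
      then show ?thesis using p by (auto simp: A_def)
    next
      case False
      define u where "u x = (INF q\<in>C. q x)" for x
      have "bdd_below ((\<lambda>q. q x) ` C)" for x
      proof (rule bdd_belowI2)
        fix q assume "q \<in> C"
        then have "sublinear q" "q (- x) \<le> p (- x)"
          using CA by (auto simp: A_def le_fun_def)
        then show "- p (- x) \<le> q x"
          using sublinear_minus[of q x] by simp
      qed
      then have lower: "u x \<le> q x" if "q \<in> C" for q x
        unfolding u_def using that by (intro cINF_lower)
      have greatest: "m \<le> u x" if "\<And>q. q \<in> C \<Longrightarrow> m \<le> q x" for m x
        unfolding u_def using that False by (intro cINF_greatest)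
      have "sublinear u"
        unfolding sublinear_def
      proof (intro conjI allI impI)
        fix x y
        have *: "u (x + y) \<le> q x + r y" if qr: "q \<in> C" "r \<in> C" for q r
        proof -
          obtain s where s: "s \<in> C" "s \<le> q" "s \<le> r"
            using chain[OF qr] qr by auto
          have "u (x + y) \<le> s x + s y"
            using lower[OF s(1), of "x + y"] sublinear_add[of s x y] s(1) CA
            by (auto simp: A_def)
          also have "\<dots> \<le> q x + r y"
            using s by (auto simp: le_fun_def intro: add_mono)
          finally show ?thesis .
        qed
        have "u (x + y) - q x \<le> u y" if "q \<in> C" for q
          using *[OF that] by (intro greatest) (simp add: algebra_simps)
        then have "u (x + y) - u y \<le> u x"
          by (intro greatest) (simp add: algebra_simps)
        then show "u (x + y) \<le> u x + u y" by simp
      next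
        fix c :: real and x assume c: "c > 0"
        have "u (c *\<^sub>R x) / c \<le> q x" if "q \<in> C" for q
          using lower[OF that, of "c *\<^sub>R x"] sublinear_scaleR[of q c x] that CA c
          by (auto simp: A_def field_simps)
        then have "u (c *\<^sub>R x) / c \<le> u x"
          by (rule greatest)
        then show "u (c *\<^sub>R x) \<le> c * u x"
          using c by (simp add: field_simps)
      qed
      moreover have "u \<le> p"
      proof (rule le_funI)
        obtain q where q: "q \<in> C" using False by blast
        then have "q \<le> p" using CA by (auto simp: A_def)
        then show "u x \<le> p x" for x
          using lower[OF q, of x] le_funD[of q p x] by simp
      qed
      ultimately show ?thesis
        using lower by (auto simp: A_def le_fun_def)
    qed
  qed
  then obtain f where f: "f \<in> A" and min: "\<And>g. g \<in> A \<Longrightarrow> g \<le> f \<Longrightarrow> g = f" by blast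
  show ?thesis
  proof
    show "sublinear f" "f \<le> p" using f by (auto simp: A_def)
    fix g assume "sublinear g" "g \<le> f"
    then show "g = f" using f by (intro min) (auto simp: A_def intro: order_trans)
  qed
qed

theorem Hahn_Banach_sublinear:
  fixes p :: "'v::real_vector \<Rightarrow> real"
  assumes p: "sublinear p"
  obtains f where "linear f" "\<And>x. f x \<le> p x" "f v = p v"
proof -
  obtain f where f: "sublinear f" and fp: "f \<le> tilt p v"
    and min: "\<And>g. sublinear g \<Longrightarrow> g \<le> f \<Longrightarrow> g = f"
    using minimal_sublinear_exists[OF sublinear_tilt[OF p]] by blast
  have "tilt f y \<le> f" for y
    using tilt_le[OF f, of 0] by (simp add: le_fun_def)
  then have tilt: "tilt f y = f" for y
    using min sublinear_tilt[OF f] by blast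
  \<comment> \<open>The infimum that defines the tilt, at parameter 1, gives \<open>f x \<le> f (x + y) - f y\<close>.\<close>
  have add: "f (x + y) = f x + f y" for x y
    using tilt_le[OF f, of 1 y x] sublinear_add[OF f, of x y] by (simp add: tilt)
  have minus: "f (- x) = - f x" for x
    using add[of x "- x"] sublinear_0[OF f] by simp
  have scale: "f (c *\<^sub>R x) = c * f x" for c x
  proof (cases c "0::real" rule: linorder_cases)
    case less
    then show ?thesis using sublinear_scaleR[OF f, of "- c" x] minus[of "c *\<^sub>R x"] by simp
  qed (use sublinear_0[OF f] sublinear_scaleR[OF f] in auto)
  have le: "f x \<le> p x" for x
    using le_funD[OF fp, of x] tilt_le[OF p, of 0 v x] by simp
  have "f (- v) \<le> p (- v + 1 *\<^sub>R v) - 1 * p v"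
    using le_funD[OF fp, of "- v"] tilt_le[OF p, of 1 v "- v"] by simp
  then have "p v \<le> f v"
    using sublinear_0[OF p] by (simp add: minus)
  with le[of v] have "f v = p v" by simp
  moreover have "linear f" by (rule linearI) (simp_all add: add scale)
  ultimately show ?thesis using le that by blast
qed

section \<open>Positive functionals and operators on Banach lattices\<close>

lemma norm_abs_eq: "norm \<bar>x\<bar> = norm (x::'b::banach_lattice)"
  by (rule antisym) (rule norm_mono_abs, simp)+

lemma norm_mono_pos: "0 \<le> x \<Longrightarrow> x \<le> y \<Longrightarrow> norm x \<le> norm (y::'b::banach_lattice)"
  by (rule norm_mono_abs) (use order_trans[of 0 x y] in simp)

lemma norm_pprt_le: "norm (pprt x) \<le> norm (x::'b::banach_lattice)"
proof -
  have "pprt x \<le> \<bar>x\<bar>" by (simp add: pprt_def abs_ge_self)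
  then show ?thesis using norm_mono_pos[of "pprt x" "\<bar>x\<bar>"] by (simp add: norm_abs_eq)
qed

lemma sublinear_norm_pprt: "sublinear (\<lambda>x::'b::banach_lattice. norm (pprt x))"
  unfolding sublinear_def
proof (intro conjI allI impI)
  fix x y :: 'b
  have "x \<le> pprt x" "y \<le> pprt y" by (simp_all add: pprt_def)
  then have "pprt (x + y) \<le> pprt x + pprt y"
    unfolding pprt_def[of "x + y"] by (simp add: add_mono)
  then have "norm (pprt (x + y)) \<le> norm (pprt x + pprt y)"
    by (rule norm_mono_pos[rotated]) simp
  also have "\<dots> \<le> norm (pprt x) + norm (pprt y)" by (rule norm_triangle_ineq)
  finally show "norm (pprt (x + y)) \<le> norm (pprt x) + norm (pprt y)" .
next
  fix c :: real and x :: 'b assume c: "c > 0"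
  have "x \<le> pprt x" by (simp add: pprt_def)
  then have "pprt (c *\<^sub>R x) \<le> c *\<^sub>R pprt x"
    unfolding pprt_def[of "c *\<^sub>R x"] using c
    by (simp add: scaleR_left_mono scaleR_nonneg_nonneg)
  then have "norm (pprt (c *\<^sub>R x)) \<le> norm (c *\<^sub>R pprt x)"
    by (rule norm_mono_pos[rotated]) simp
  then show "norm (pprt (c *\<^sub>R x)) \<le> c * norm (pprt x)" using c by simp
qed

lemma positive_operatorD: "positive_operator T \<Longrightarrow> 0 \<le> x \<Longrightarrow> 0 \<le> T x"
  by (simp add: positive_operator_def)

lemma positive_operator_mono:
  assumes "positive_operator T" "x \<le> y"
  shows "T x \<le> T y"
  using positive_operatorD[OF assms(1), of "y - x"] assms(2) by (simp add: blinfun.diff_right)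

text \<open>
  A linear functional dominated by the norm of the positive part is automatically positive,
  because that norm vanishes on negative elements.
\<close>

lemma positive_norming_functional:
  fixes u :: "'b::banach_lattice"
  assumes "u \<ge> 0"
  obtains \<phi> :: "'b \<Rightarrow>\<^sub>L real" where "positive_operator \<phi>" "norm \<phi> \<le> 1" "\<phi> u = norm u"
proof -
  obtain f where lin: "linear f" and le: "\<And>x. f x \<le> norm (pprt x)" and u: "f u = norm (pprt u)"
    using Hahn_Banach_sublinear[OF sublinear_norm_pprt] by blast
  have bound: "\<bar>f x\<bar> \<le> norm x" for x
    using le[of x] le[of "- x"] norm_pprt_le[of x] norm_pprt_le[of "- x"]
    by (simp add: linear_neg[OF lin])
  then have "bounded_linear f"
    using lin by (intro bounded_linear_intro[of f 1]) (simp_all add: linear_add linear_scale)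
  then have f: "blinfun_apply (Blinfun f) = f" by (rule bounded_linear_Blinfun_apply)
  have "f x \<ge> 0" if "x \<ge> 0" for x
    using le[of "- x"] that by (simp add: linear_neg[OF lin])
  then have "positive_operator (Blinfun f)" by (simp add: positive_operator_def f)
  moreover have "norm (Blinfun f) \<le> 1" using bound by (intro norm_blinfun_bound) (simp_all add: f)
  moreover have "Blinfun f u = norm u" using u assms by (simp add: f)
  ultimately show ?thesis using that by blast
qed

lemma norm_positive_operator_le:
  fixes T :: "'a::banach_lattice \<Rightarrow>\<^sub>L 'b::banach_lattice"
  assumes pos: "positive_operator T" and c: "0 \<le> c"
    and le: "\<And>x. 0 \<le> x \<Longrightarrow> norm x \<le> 1 \<Longrightarrow> norm (T x) \<le> c"
  shows "norm T \<le> c"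
proof (rule norm_blinfun_bound[OF c])
  fix x
  have "T x \<le> T \<bar>x\<bar>" "- T x \<le> T \<bar>x\<bar>"
    using positive_operator_mono[OF pos abs_ge_self[of x]]
      positive_operator_mono[OF pos abs_ge_minus_self[of x]]
    by (simp_all add: blinfun.minus_right)
  then have "\<bar>T x\<bar> \<le> \<bar>T \<bar>x\<bar>\<bar>"
    by (meson abs_ge_self abs_leI order_trans)
  then have *: "norm (T x) \<le> norm (T \<bar>x\<bar>)" by (rule norm_mono_abs)
  show "norm (T x) \<le> c * norm x"
  proof (cases "x = 0")
    case False
    have "norm (T ((1 / norm x) *\<^sub>R \<bar>x\<bar>)) \<le> c"
      using False by (intro le) (simp_all add: norm_abs_eq scaleR_nonneg_nonneg)
    then have "norm (T \<bar>x\<bar>) \<le> c * norm x"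
      using False by (simp add: blinfun.scaleR_right field_simps)
    with * show ?thesis by simp
  qed simp
qed

section \<open>Increasing functionals on reflexive spaces\<close>

lemma compact_bounded_functions:
  fixes c :: "'i \<Rightarrow> real"
  shows "compact {q. \<forall>i. \<bar>q i\<bar> \<le> c i}"
proof -
  have "{q. \<forall>i. \<bar>q i\<bar> \<le> c i} = PiE UNIV (\<lambda>i. {- c i..c i})"
    by (auto simp: PiE_def Pi_def abs_le_iff) (metis minus_le_iff)+
  moreover have "compactin (product_topology (\<lambda>i. euclidean) UNIV) (PiE UNIV (\<lambda>i. {- c i..c i}))"
    by (simp add: compactin_PiE)
  ultimately show ?thesis
    by (simp add: euclidean_product_topology flip: compactin_euclidean_iff)
qed

text \<open>
  Evaluations at \<open>x n\<close> form a sequence in a product of compact intervals, indexed by the dual space, so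
  they have a cluster point there by Tychonoff's theorem. It is a bounded linear functional on the
  dual, hence evaluation at some \<open>z\<close>. The filter \<open>F\<close> plays the role of a convergent subnet.
\<close>

lemma reflexive_weak_cluster_point:
  fixes x :: "nat \<Rightarrow> 'a::banach"
  assumes refl: "reflexive_space TYPE('a)" and bdd: "\<And>n. norm (x n) \<le> 1"
  obtains z F where "F \<noteq> bot" "F \<le> sequentially"
    "\<And>h :: 'a \<Rightarrow>\<^sub>L real. ((\<lambda>n. h (x n)) \<longlongrightarrow> h z) F"
proof -
  define q where "q n = (\<lambda>h :: 'a \<Rightarrow>\<^sub>L real. h (x n))" for n
  define U where "U = {q. \<forall>h :: 'a \<Rightarrow>\<^sub>L real. \<bar>q h\<bar> \<le> norm h}"
  have "q n \<in> U" for n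
  proof -
    have "\<bar>h (x n)\<bar> \<le> norm h" for h :: "'a \<Rightarrow>\<^sub>L real"
      using norm_blinfun[of h "x n"] mult_left_mono[OF bdd[of n], of "norm h"] by simp
    then show ?thesis by (simp add: q_def U_def)
  qed
  then have "eventually (\<lambda>p. p \<in> U) (filtermap q sequentially)"
    by (simp add: eventually_filtermap)
  moreover have "compact U" unfolding U_def by (rule compact_bounded_functions)
  ultimately obtain p where p: "p \<in> U" "inf (nhds p) (filtermap q sequentially) \<noteq> bot"
    unfolding compact_filter le_principal by (metis filtermap_bot_iff sequentially_bot)
  define F where "F = inf (filtercomap q (nhds p)) sequentially"
  have F: "F \<noteq> bot"
  proof
    assume "F = bot"
    then have "\<forall>\<^sub>F n in inf (filtercomap q (nhds p)) sequentially. False" by (simp add: F_def)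
    then obtain P Q where P: "eventually P (filtercomap q (nhds p))" and Q: "eventually Q sequentially"
      and PQ: "\<And>n. P n \<Longrightarrow> Q n \<Longrightarrow> False"
      unfolding eventually_inf by blast
    from P obtain R where R: "eventually R (nhds p)" and RP: "\<And>n. R (q n) \<Longrightarrow> P n"
      unfolding eventually_filtercomap by blast
    have "eventually (\<lambda>y. \<not> R y) (filtermap q sequentially)"
      unfolding eventually_filtermap using Q by eventually_elim (use RP PQ in blast)
    with R have "eventually (\<lambda>y. False) (inf (nhds p) (filtermap q sequentially))"
      unfolding eventually_inf by blast
    with p(2) show False by (simp add: eventually_False)
  qed
  have "filterlim q (nhds p) F"
    unfolding F_def by (rule filterlim_mono[OF filterlim_filtercomap]) auto
  then have lim: "((\<lambda>n. h (x n)) \<longlongrightarrow> p h) F" for h :: "'a \<Rightarrow>\<^sub>L real"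
  proof (intro topological_tendstoI)
    fix S assume F: "filterlim q (nhds p) F" and S: "open S" "p h \<in> S"
    have "open ((\<lambda>y. y h) -` S)"
      by (rule open_vimage[OF S(1) continuous_on_product_coordinates])
    then have "\<forall>\<^sub>F y in nhds p. y h \<in> S"
      using S(2) eventually_nhds_in_open[of "(\<lambda>y. y h) -` S" p] by simp
    then show "\<forall>\<^sub>F n in F. h (x n) \<in> S"
      using eventually_compose_filterlim[OF _ F] by (simp add: q_def)
  qed
  have "bounded_linear p"
  proof (rule bounded_linear_intro)
    fix g h :: "'a \<Rightarrow>\<^sub>L real" and c :: real
    have "((\<lambda>n. (g + h) (x n)) \<longlongrightarrow> p g + p h) F"
      using tendsto_add[OF lim lim] by (simp add: blinfun.add_left)
    then show "p (g + h) = p g + p h"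
      using lim tendsto_unique[OF F] by blast
    have "((\<lambda>n. (c *\<^sub>R h) (x n)) \<longlongrightarrow> c *\<^sub>R p h) F"
      using tendsto_scaleR[OF tendsto_const lim] by (simp add: blinfun.scaleR_left)
    then show "p (c *\<^sub>R h) = c *\<^sub>R p h"
      using lim tendsto_unique[OF F] by blast
    show "norm (p h) \<le> norm h * 1"
      using p(1) by (simp add: U_def)
  qed
  then have p_apply: "blinfun_apply (Blinfun p) = p"
    by (rule bounded_linear_Blinfun_apply)
  obtain z where "Blinfun p = canonical_embedding z"
    using refl unfolding reflexive_space_def by (meson surjD)
  then have "p h = h z" for h
    by (metis p_apply canonical_embedding_apply)
  then have "((\<lambda>n. h (x n)) \<longlongrightarrow> h z) F" for h :: "'a \<Rightarrow>\<^sub>L real"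
    using lim[of h] by simp
  moreover have "F \<le> sequentially" by (simp add: F_def)
  ultimately show ?thesis using F that by blast
qed

text \<open>
  Dini's argument: the sequence has a pointwise limit functional \<open>L\<close>, and \<open>L - f n\<close> decreases. Without
  norm convergence there would be positive \<open>x n\<close> in the unit ball at which \<open>L - f n\<close> exceeds a fixed
  positive number, and so does \<open>L - f j\<close> for \<open>j \<le> n\<close>. At a weak cluster point of \<open>x\<close> every \<open>L - f j\<close>
  would then be at least that number, against pointwise convergence.
\<close>

lemma increasing_functionals_Cauchy:
  fixes f :: "nat \<Rightarrow> ('a::banach_lattice \<Rightarrow>\<^sub>L real)"
  assumes refl: "reflexive_space TYPE('a)"
    and mono: "\<And>n m. n \<le> m \<Longrightarrow> operator_le (f n) (f m)"
    and le: "\<And>n. operator_le (f n) g"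
  shows "Cauchy f"
proof -
  have f_mono: "f n x \<le> f m x" if "n \<le> m" "0 \<le> x" for n m x
    using mono[OF that(1)] that(2)
    by (simp add: operator_le_def positive_operator_def blinfun.diff_left)
  have f_le: "f n x \<le> g x" if "0 \<le> x" for n x
    using le[of n] that by (simp add: operator_le_def positive_operator_def blinfun.diff_left)
  have conv_pos: "convergent (\<lambda>n. f n x)" if "0 \<le> x" for x
  proof -
    have "incseq (\<lambda>n. f n x)" using that f_mono by (simp add: incseq_def)
    then show ?thesis
      using incseq_convergent[of "\<lambda>n. f n x" "g x"] that f_le unfolding convergent_def by metis
  qed
  have conv: "convergent (\<lambda>n. f n x)" for x
  proof -
    have "f n x = f n (pprt x) - f n (- nprt x)" for n
      using prts[of x] by (metis blinfun.diff_right diff_minus_eq_add)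
    moreover have "convergent (\<lambda>n. f n (pprt x) - f n (- nprt x))"
      by (intro convergent_diff conv_pos) auto
    ultimately show ?thesis by simp
  qed
  define L where "L x = lim (\<lambda>n. f n x)" for x
  have L: "(\<lambda>n. f n x) \<longlonglongrightarrow> L x" for x
    using conv[of x] by (simp add: L_def convergent_LIMSEQ_iff)
  define b where "b = norm (f 0) + norm (g - f 0)"
  have fb: "norm (f n) \<le> b" for n
  proof -
    have "norm (f n - f 0) \<le> norm (g - f 0)"
    proof (rule norm_positive_operator_le)
      show "positive_operator (f n - f 0)" using mono[of 0 n] by (simp add: operator_le_def)
      fix x :: 'a assume x: "0 \<le> x" "norm x \<le> 1"
      have "norm ((f n - f 0) x) \<le> norm ((g - f 0) x)"
        using f_mono[of 0 n x] f_le[of x n] x by (simp add: blinfun.diff_left)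
      also have "\<dots> \<le> norm (g - f 0) * 1"
        using norm_blinfun[of "g - f 0" x] mult_left_mono[OF x(2) norm_ge_zero]
        by (rule order_trans)
      finally show "norm ((f n - f 0) x) \<le> norm (g - f 0)" by simp
    qed simp
    then show ?thesis
      unfolding b_def using norm_triangle_ineq[of "f 0" "f n - f 0"] by simp
  qed
  have "bounded_linear L"
  proof (rule bounded_linear_intro)
    fix x y :: 'a and c :: real
    show "L (x + y) = L x + L y"
      by (rule LIMSEQ_unique[OF L]) (use tendsto_add[OF L L] in \<open>simp add: blinfun.add_right\<close>)
    show "L (c *\<^sub>R x) = c *\<^sub>R L x"
      by (rule LIMSEQ_unique[OF L])
        (use tendsto_scaleR[OF tendsto_const L] in \<open>simp add: blinfun.scaleR_right\<close>)
    have "\<bar>f n x\<bar> \<le> norm x * b" for n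
      using norm_blinfun[of "f n" x] mult_right_mono[OF fb[of n], of "norm x"]
      by (simp add: mult.commute)
    then show "norm (L x) \<le> norm x * b"
      using tendsto_upperbound[OF tendsto_rabs[OF L[of x]]] by simp
  qed
  then have L_apply: "blinfun_apply (Blinfun L) = L"
    by (rule bounded_linear_Blinfun_apply)
  have f_le_L: "f n x \<le> L x" if "0 \<le> x" for n x
    by (rule LIMSEQ_le_const[OF L]) (use f_mono that in blast)
  have "f \<longlonglongrightarrow> Blinfun L"
  proof (rule ccontr)
    assume "\<not> ?thesis"
    then obtain e where e: "e > 0" and far: "\<And>N. \<exists>n\<ge>N. norm (f n - Blinfun L) \<ge> e"
      unfolding LIMSEQ_iff by (meson not_le)
    have "\<exists>x. 0 \<le> x \<and> norm x \<le> 1 \<and> e / 2 < L x - f n x" for n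
    proof (rule ccontr)
      assume none: "\<not> ?thesis"
      obtain m where m: "m \<ge> n" "norm (f m - Blinfun L) \<ge> e" using far by blast
      have "norm (Blinfun L - f m) \<le> e / 2"
      proof (rule norm_positive_operator_le)
        show "positive_operator (Blinfun L - f m)"
          by (simp add: positive_operator_def blinfun.diff_left L_apply f_le_L)
        fix x :: 'a assume "0 \<le> x" "norm x \<le> 1"
        then show "norm ((Blinfun L - f m) x) \<le> e / 2"
          using none f_le_L[of x m] f_mono[OF m(1), of x]
          by (force simp: blinfun.diff_left L_apply)
      qed (use e in simp)
      then show False using m e by (simp add: norm_minus_commute)
    qed
    then obtain x where x: "\<And>n. 0 \<le> x n" "\<And>n. norm (x n) \<le> 1"
      and gap: "\<And>n. e / 2 < L (x n) - f n (x n)"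
      by metis
    obtain z F where F: "F \<noteq> bot" "F \<le> sequentially"
      and z: "\<And>h :: 'a \<Rightarrow>\<^sub>L real. ((\<lambda>n. h (x n)) \<longlongrightarrow> h z) F"
      using reflexive_weak_cluster_point[OF refl, of x] x(2) by blast
    have "e / 2 \<le> L z - f j z" for j
    proof -
      have "\<forall>\<^sub>F n in sequentially. e / 2 \<le> (Blinfun L - f j) (x n)"
        using eventually_ge_at_top[of j]
      proof eventually_elim
        case (elim n)
        then show ?case
          using gap[of n] f_mono[OF elim x(1)[of n]] by (simp add: blinfun.diff_left L_apply)
      qed
      then have "\<forall>\<^sub>F n in F. e / 2 \<le> (Blinfun L - f j) (x n)"
        using F(2) by (simp add: filter_leD)
      then have "e / 2 \<le> (Blinfun L - f j) z"
        using F(1) z[of "Blinfun L - f j"] by (intro tendsto_lowerbound) auto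
      then show ?thesis by (simp add: blinfun.diff_left L_apply)
    qed
    moreover have "(\<lambda>j. L z - f j z) \<longlonglongrightarrow> L z - L z"
      by (intro tendsto_diff tendsto_const L)
    ultimately have "e / 2 \<le> L z - L z"
      by (intro LIMSEQ_le_const) auto
    then show False using e by simp
  qed
  then show ?thesis by (rule LIMSEQ_imp_Cauchy)
qed

section \<open>Sequences in spaces with order continuous norm\<close>

lemma banach_lattice_archimedean:
  fixes z v :: "'b::banach_lattice"
  assumes z: "0 \<le> z" and le: "\<And>k::nat. of_nat k *\<^sub>R z \<le> v"
  shows "z = 0"
proof (rule ccontr)
  assume "z \<noteq> 0"
  then obtain k :: nat where "norm v < of_nat k * norm z"
    using reals_Archimedean3[of "norm z"] by auto
  moreover have "norm (of_nat k *\<^sub>R z) \<le> norm v"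
    using z le by (intro norm_mono_pos) (simp_all add: scaleR_nonneg_nonneg)
  ultimately show False by simp
qed

text \<open>
  No supremum of \<open>x\<close> is assumed to exist. Instead, order continuity is applied to the directed set of
  all \<open>x n - y\<close> with \<open>y\<close> an upper bound of \<open>x\<close>, which has supremum \<open>0\<close> by the Archimedean property.
  So some \<open>x n\<close> is close in norm to an upper bound, and all later terms lie between the two.
\<close>

lemma bounded_increasing_Cauchy:
  fixes x :: "nat \<Rightarrow> 'b::banach_lattice"
  assumes ocn: "order_continuous_norm TYPE('b)"
    and inc: "incseq x" and bdd: "\<And>n. x n \<le> u"
  shows "Cauchy x"
proof -
  define U where "U = {y. \<forall>n. x n \<le> y}"
  define I where "I = {x n - y | n y. y \<in> U}"
  have dir: "directed_preorder I (\<le>)"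
    unfolding directed_preorder_def
  proof (intro conjI ballI impI)
    show "I \<noteq> {}" using bdd by (auto simp: I_def U_def)
    fix a b assume "a \<in> I" "b \<in> I"
    then obtain m n y z where mn: "a = x m - y" "b = x n - z" and yz: "y \<in> U" "z \<in> U"
      by (auto simp: I_def)
    have "inf y z \<in> U" using yz by (simp add: U_def)
    then have "x (max m n) - inf y z \<in> I" unfolding I_def by blast
    moreover have "a \<le> x (max m n) - inf y z" "b \<le> x (max m n) - inf y z"
      unfolding mn by (intro diff_mono incseqD[OF inc]; simp)+
    ultimately show "\<exists>k\<in>I. a \<le> k \<and> b \<le> k" by blast
  qed auto
  have "isLub UNIV ((\<lambda>a. a) ` I) 0"
  proof (rule isLubI2)
    show "isUb UNIV ((\<lambda>a. a) ` I) 0"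
      by (auto simp: isUb_def setle_def I_def U_def)
    have "0 \<le> b" if "isUb UNIV ((\<lambda>a. a) ` I) b" for b
    proof -
      have b: "x n - y \<le> b" if "y \<in> U" for n y
        using \<open>isUb _ _ b\<close> that by (auto simp: isUb_def setle_def I_def)
      define z where "z = - inf b 0"
      have z0: "0 \<le> z"
        unfolding z_def by (metis inf_le2 neg_0_le_iff_le)
      \<comment> \<open>Subtracting \<open>z\<close> from an upper bound of \<open>x\<close> leaves an upper bound; this can be iterated.\<close>
      have step: "y - z \<in> U" if y: "y \<in> U" for y
      proof -
        have "x n \<le> y - z" for n
        proof -
          have "x n - y \<le> 0" using y by (simp add: U_def)
          then have "x n - y \<le> - z" using b[OF y] unfolding z_def minus_minus by (rule le_infI[rotated])
          then show ?thesis by (simp add: algebra_simps)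
        qed
        then show ?thesis by (simp add: U_def)
      qed
      have *: "u - of_nat k *\<^sub>R z \<in> U" for k
      proof (induction k)
        case 0
        then show ?case using bdd by (simp add: U_def)
      next
        case (Suc k)
        then show ?case using step[OF Suc] by (simp add: algebra_simps)
      qed
      have "of_nat k *\<^sub>R z \<le> u - x 0" for k
      proof -
        have "x 0 \<le> u - of_nat k *\<^sub>R z" using * by (auto simp: U_def)
        then show ?thesis by (simp add: le_diff_eq add.commute)
      qed
      then have "z = 0" using banach_lattice_archimedean z0 by blast
      then have "inf b 0 = 0" unfolding z_def by (simp only: neg_equal_0_iff_equal)
      then show "0 \<le> b" by (metis inf_le1)
    qed
    then show "0 <=* Collect (isUb UNIV ((\<lambda>a. a) ` I))"
      by (simp add: setge_def)
  qed
  then have lim: "((\<lambda>a. a) \<longlongrightarrow> 0) (net_filter I (\<le>))"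
    using ocn dir unfolding order_continuous_norm_def by (simp add: monotone_on_def)
  show ?thesis
    unfolding Cauchy_altdef2
  proof (intro allI impI)
    fix e :: real assume e: "e > 0"
    then have "\<forall>\<^sub>F a in net_filter I (\<le>). dist a 0 < e"
      using lim by (rule tendstoD[rotated])
    then obtain a where "a \<in> I" "norm a < e"
      unfolding eventually_net_filter[OF dir] by auto
    then obtain N y where y: "y \<in> U" and small: "norm (x N - y) < e" by (auto simp: I_def)
    have "dist (x n) (x N) < e" if "n \<ge> N" for n
    proof -
      have "norm (x n - x N) \<le> norm (y - x N)"
        using y incseqD[OF inc that] by (intro norm_mono_pos diff_mono) (auto simp: U_def)
      then show ?thesis using small by (simp add: dist_norm norm_minus_commute)
    qed
    then show "\<exists>N. \<forall>n\<ge>N. dist (x n) (x N) < e" by blast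
  qed
qed

lemma closed_nonneg_cone: "closed {x::'b::banach_lattice. 0 \<le> x}"
  unfolding closed_sequential_limits
proof (intro allI impI; elim conjE)
  fix x :: "nat \<Rightarrow> 'b" and l assume x: "\<forall>n. x n \<in> {x. 0 \<le> x}" and l: "x \<longlonglongrightarrow> l"
  have "norm (pprt (- l)) \<le> norm (x n - l)" for n
  proof -
    have "- l \<le> x n - l" using x by simp
    also have "\<dots> \<le> \<bar>x n - l\<bar>" by (rule abs_ge_self)
    finally have "pprt (- l) \<le> \<bar>x n - l\<bar>" by (simp add: pprt_def)
    then have "norm (pprt (- l)) \<le> norm \<bar>x n - l\<bar>"
      by (intro norm_mono_pos) simp_all
    then show ?thesis by (simp add: norm_abs_eq)
  qed
  moreover have "(\<lambda>n. norm (x n - l)) \<longlonglongrightarrow> 0"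
    using l by (simp add: LIM_zero_iff tendsto_norm_zero)
  ultimately have "norm (pprt (- l)) \<le> 0"
    by (intro LIMSEQ_le_const) auto
  then show "l \<in> {x. 0 \<le> x}"
    by (simp add: le_zero_iff_zero_pprt[of "- l", symmetric])
qed

lemma banach_lattice_LIMSEQ_le:
  fixes x y :: "nat \<Rightarrow> 'b::banach_lattice"
  assumes "x \<longlonglongrightarrow> a" "y \<longlonglongrightarrow> b" "\<forall>\<^sub>F n in sequentially. x n \<le> y n"
  shows "a \<le> b"
proof -
  have "b - a \<in> {z. 0 \<le> z}"
    by (rule Lim_in_closed_set[OF closed_nonneg_cone _ _ tendsto_diff[OF assms(2,1)]])
       (use assms(3) in simp_all)
  then show ?thesis by simp
qed

text \<open>The finite supremum of \<open>y n, \<dots>, y (n + N)\<close>.\<close>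

fun sup_upto :: "(nat \<Rightarrow> 'b::lattice) \<Rightarrow> nat \<Rightarrow> nat \<Rightarrow> 'b" where
  "sup_upto y n 0 = y n"
| "sup_upto y n (Suc N) = sup (sup_upto y n N) (y (n + Suc N))"

lemma sup_upto_ge: "i \<le> N \<Longrightarrow> y (n + i) \<le> sup_upto y n N"
  by (induction N) (auto simp: le_Suc_eq intro: le_supI1)

lemma sup_upto_least: "(\<And>i. i \<le> N \<Longrightarrow> y (n + i) \<le> b) \<Longrightarrow> sup_upto y n N \<le> b"
proof (induction N)
  case (Suc N)
  then show ?case using Suc.prems[of "Suc N"] by simp
next
  case 0
  then show ?case using "0.prems"[of 0] by simp
qed

lemma sup_upto_Suc_le: "sup_upto y (Suc n) N \<le> sup_upto y n (Suc N)"
proof (rule sup_upto_least)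
  show "y (Suc n + i) \<le> sup_upto y n (Suc N)" if "i \<le> N" for i
    using that sup_upto_ge[of "Suc i" "Suc N" y n] by simp
qed

lemma sup_upto_functional_le:
  fixes y :: "nat \<Rightarrow> 'b::banach_lattice" and \<phi> :: "'b \<Rightarrow>\<^sub>L real"
  assumes pos: "positive_operator \<phi>" and y: "\<And>n. 0 \<le> y n"
  shows "\<phi> (sup_upto y n N) \<le> (\<Sum>i\<le>N. \<phi> (y (n + i)))"
proof (induction N)
  case (Suc N)
  have "0 \<le> sup_upto y n N"
    using y[of n] sup_upto_ge[of 0 N y n] by (simp add: order_trans)
  then have "sup_upto y n (Suc N) \<le> sup_upto y n N + y (n + Suc N)"
    using y[of "n + Suc N"] by simp
  then have "\<phi> (sup_upto y n (Suc N)) \<le> \<phi> (sup_upto y n N) + \<phi> (y (n + Suc N))"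
    using positive_operator_mono[OF pos] by (metis blinfun.add_right)
  with Suc show ?case by simp
qed simp

text \<open>
  Let \<open>\<phi> l\<close> norm the supremum \<open>c l\<close> of the terms of \<open>y\<close> listed in \<open>l\<close>. Finite lists being countable,
  a diagonal choice gives terms \<open>v j\<close> with \<open>\<phi> l (v j) < (1/2) ^ j\<close> for all but finitely many \<open>j\<close>. If
  all terms had norm at least \<open>e\<close>, the tail suprema \<open>w n\<close> of \<open>v\<close> would form a decreasing, hence
  Cauchy, sequence of norm at least \<open>e\<close>. Choosing \<open>l\<close> with \<open>c l\<close> close to \<open>w n\<close> for all large \<open>n\<close> keeps
  \<open>\<phi> l (w n)\<close> away from \<open>0\<close>, but for large \<open>n\<close> a tail of a geometric series bounds it.
\<close>

lemma order_bounded_weakly_null: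
  fixes y :: "nat \<Rightarrow> 'b::banach_lattice"
  assumes ocn: "order_continuous_norm TYPE('b)"
    and y: "\<And>n. 0 \<le> y n" "\<And>n. y n \<le> u"
    and null: "\<And>\<phi> :: 'b \<Rightarrow>\<^sub>L real. positive_operator \<phi> \<Longrightarrow> (\<lambda>n. \<phi> (y n)) \<longlonglongrightarrow> 0"
    and e: "0 < e"
  shows "\<exists>n. norm (y n) < e"
proof (rule ccontr)
  assume "\<not> ?thesis"
  then have big: "e \<le> norm (y n)" for n by (meson not_le)
  define c where "c l = foldr sup (map y l) 0" for l
  have c0: "0 \<le> c l" for l
    unfolding c_def by (induction l) (auto intro: le_supI2)
  have "\<exists>\<phi> :: 'b \<Rightarrow>\<^sub>L real. positive_operator \<phi> \<and> norm \<phi> \<le> 1 \<and> \<phi> (c l) = norm (c l)" for l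
    using positive_norming_functional[OF c0] by metis
  then obtain \<phi> :: "nat list \<Rightarrow> ('b \<Rightarrow>\<^sub>L real)" where \<phi>: "\<And>l. positive_operator (\<phi> l)"
      "\<And>l. norm (\<phi> l) \<le> 1" "\<And>l. \<phi> l (c l) = norm (c l)"
    by metis
  \<comment> \<open>Only the first \<open>j + 1\<close> functionals are constrained at stage \<open>j\<close>. The indices chosen need not
    be increasing.\<close>
  have "\<exists>k. \<forall>i\<le>j. \<phi> (from_nat i) (y k) < (1/2) ^ j" for j :: nat
  proof -
    have "\<forall>\<^sub>F k in sequentially. \<phi> (from_nat i) (y k) < (1/2) ^ j" for i
      using null[OF \<phi>(1)] by (rule order_tendstoD) simp
    then have "\<forall>\<^sub>F k in sequentially. \<forall>i\<in>{..j}. \<phi> (from_nat i) (y k) < (1/2) ^ j"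
      by (intro eventually_ball_finite) auto
    then show ?thesis by (auto simp: eventually_sequentially)
  qed
  then obtain \<sigma> where \<sigma>: "\<And>i j. i \<le> j \<Longrightarrow> \<phi> (from_nat i) (y (\<sigma> j)) < (1/2) ^ j"
    by metis
  define v where "v n = y (\<sigma> n)" for n
  have v: "0 \<le> v n" "v n \<le> u" "e \<le> norm (v n)" for n
    using y big by (simp_all add: v_def)
  define s where "s n N = sup_upto v n N" for n N
  have s_range: "v n \<le> s n N" "s n N \<le> u" for n N
    using sup_upto_ge[of 0 N v n] sup_upto_least[of N v n u] v by (simp_all add: s_def)
  have s_c: "\<exists>l. s n N = c l" for n N
  proof (induction N)
    case 0
    have "s n 0 = c [\<sigma> n]" using v by (simp add: s_def c_def v_def sup_absorb1)
    then show ?case ..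
  next
    case (Suc N)
    then obtain l where "s n N = c l" ..
    then have "s n (Suc N) = c (\<sigma> (n + Suc N) # l)"
      by (simp add: s_def c_def v_def sup_commute)
    then show ?case ..
  qed
  have "Cauchy (s n)" for n
    by (rule bounded_increasing_Cauchy[OF ocn _ s_range(2)]) (simp add: incseq_SucI s_def)
  then have "convergent (s n)" for n
    by (rule Cauchy_convergent)
  then obtain w where w: "\<And>n. s n \<longlonglongrightarrow> w n"
    unfolding convergent_def by metis
  have w_ge: "v n \<le> w n" for n
    by (rule banach_lattice_LIMSEQ_le[OF tendsto_const w[of n]]) (simp add: s_range)
  have "w (Suc n) \<le> w n" for n
    by (rule banach_lattice_LIMSEQ_le[OF w LIMSEQ_Suc[OF w]])
       (simp add: s_def sup_upto_Suc_le del: sup_upto.simps)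
  then have "incseq (\<lambda>n. - w n)" by (intro incseq_SucI) simp
  moreover have "- w n \<le> 0" for n
    using order_trans[OF v(1) w_ge, of n] by simp
  ultimately have "Cauchy (\<lambda>n. - w n)"
    by (rule bounded_increasing_Cauchy[OF ocn])
  then have "\<exists>n0. \<forall>n\<ge>n0. dist (- w n) (- w n0) < e / 4"
    unfolding Cauchy_altdef2 by (rule allE[of _ "e / 4"]) (use e in simp)
  then obtain n0 where n0: "\<And>n. n \<ge> n0 \<Longrightarrow> norm (w n - w n0) < e / 4"
    by (metis dist_minus dist_norm)
  obtain N0 where N0: "norm (s n0 N0 - w n0) < e / 4"
  proof -
    have "\<exists>N0. \<forall>N\<ge>N0. norm (s n0 N - w n0) < e / 4"
      using LIMSEQ_D[OF w[of n0], of "e / 4"] e by simp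
    then show ?thesis using that by blast
  qed
  obtain l where l: "s n0 N0 = c l" using s_c by blast
  define i where "i = to_nat l"
  have \<phi>_le: "\<bar>\<phi> l z\<bar> \<le> norm z" for z
    using norm_blinfun[of "\<phi> l" z] mult_right_mono[OF \<phi>(2)[of l], of "norm z"] by simp
  have lower: "e / 4 < \<phi> l (w n)" if "n \<ge> n0" for n
  proof -
    have "e \<le> norm (s n0 N0)"
      using v(3)[of n0] norm_mono_pos[OF v(1) s_range(1), of n0 N0] by simp
    also have "\<dots> = \<phi> l (s n0 N0 - w n0) - \<phi> l (w n - w n0) + \<phi> l (w n)"
      using \<phi>(3)[of l] by (simp add: l blinfun.diff_right)
    finally show ?thesis
      using \<phi>_le[of "s n0 N0 - w n0"] \<phi>_le[of "w n - w n0"] N0 n0[OF that] by linarith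
  qed
  have upper: "\<phi> l (w n) \<le> 2 * (1/2) ^ n" if "n \<ge> i" for n
  proof -
    have "\<phi> l (s n N) \<le> 2 * (1/2) ^ n" for N
    proof -
      have "\<phi> l (s n N) \<le> (\<Sum>j\<le>N. \<phi> l (v (n + j)))"
        unfolding s_def by (rule sup_upto_functional_le[OF \<phi>(1) v(1)])
      also have "\<dots> \<le> (\<Sum>j\<le>N. (1/2) ^ (n + j))"
        using \<sigma>[of i] that by (intro sum_mono) (simp add: v_def i_def less_imp_le)
      also have "\<dots> = (1/2) ^ n * (\<Sum>j\<le>N. (1/2::real) ^ j)"
        by (simp add: power_add sum_distrib_left)
      also have "(\<Sum>j\<le>N. (1/2::real) ^ j) \<le> 2"
        using geometric_sum[of "1/2::real" "Suc N"] by (simp add: lessThan_Suc_atMost)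
      finally show ?thesis by (simp add: mult.commute)
    qed
    moreover have "(\<lambda>N. \<phi> l (s n N)) \<longlonglongrightarrow> \<phi> l (w n)"
      by (intro blinfun.tendsto w tendsto_const)
    ultimately show ?thesis by (intro LIMSEQ_le_const2) auto
  qed
  have "(\<lambda>n. 2 * (1/2::real) ^ n) \<longlonglongrightarrow> 2 * 0"
    by (intro tendsto_mult tendsto_const LIMSEQ_realpow_zero) auto
  then have "\<forall>\<^sub>F n in sequentially. 2 * (1/2::real) ^ n < e / 4"
    using e by (intro order_tendstoD(2)[of _ "2 * 0"]) auto
  then obtain n where "n \<ge> n0" "n \<ge> i" "2 * (1/2::real) ^ n < e / 4"
    unfolding eventually_sequentially by (metis max.bounded_iff order_refl)
  then show False using lower[of n] upper[of n] by simp
qed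

section \<open>Compact operators\<close>

lemma compact_operators_iff_totally_bounded:
  fixes T :: "'a::real_normed_vector \<Rightarrow>\<^sub>L 'b::banach"
  shows "T \<in> compact_operators \<longleftrightarrow>
    (\<forall>e>0. \<exists>k. finite k \<and> (\<forall>x\<in>cball 0 1. \<exists>a\<in>k. norm (T x - a) < e))"
    (is "_ \<longleftrightarrow> ?tb")
proof
  assume "T \<in> compact_operators"
  then have "\<forall>e>0. \<exists>k. finite k \<and> closure (T ` cball 0 1) \<subseteq> (\<Union>a\<in>k. ball a e)"
    by (simp add: compact_operators_def compact_eq_totally_bounded)
  moreover have "\<exists>a\<in>k. norm (T x - a) < e"
    if sub: "closure (T ` cball 0 1) \<subseteq> (\<Union>a\<in>k. ball a e)" and x: "x \<in> cball 0 1" for k e x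
  proof -
    have "T x \<in> (\<Union>a\<in>k. ball a e)"
      using sub closure_subset x by blast
    then show ?thesis by (auto simp: dist_norm norm_minus_commute)
  qed
  ultimately show ?tb by metis
next
  assume tb: ?tb
  have "\<exists>k. finite k \<and> closure (T ` cball 0 1) \<subseteq> (\<Union>a\<in>k. ball a e)" if e: "e > 0" for e
  proof -
    obtain k where k: "finite k" "\<And>x. x \<in> cball 0 1 \<Longrightarrow> \<exists>a\<in>k. norm (T x - a) < e / 2"
      using tb e by (metis half_gt_zero)
    have "T ` cball 0 1 \<subseteq> (\<Union>a\<in>k. cball a (e / 2))"
      using k(2) by (fastforce simp: dist_norm norm_minus_commute)
    then have "closure (T ` cball 0 1) \<subseteq> (\<Union>a\<in>k. cball a (e / 2))"
      using k(1) by (intro closure_minimal closed_UN) auto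
    also have "\<dots> \<subseteq> (\<Union>a\<in>k. ball a e)"
      using e by (intro UN_mono) (auto simp: subset_eq)
    finally show ?thesis using k(1) by blast
  qed
  then show "T \<in> compact_operators"
    by (simp add: compact_operators_def compact_eq_totally_bounded complete_eq_closed)
qed

lemma norm_blinfun_le_on_cball:
  "x \<in> cball 0 1 \<Longrightarrow> norm (blinfun_apply T x) \<le> norm T"
  using norm_blinfun[of T x] mult_left_mono[of "norm x" 1 "norm T"] by simp

lemma compact_operators_LIMSEQ:
  fixes T :: "nat \<Rightarrow> 'a::real_normed_vector \<Rightarrow>\<^sub>L 'b::banach"
  assumes T: "\<And>n. T n \<in> compact_operators" and L: "T \<longlonglongrightarrow> L"
  shows "L \<in> compact_operators"
  unfolding compact_operators_iff_totally_bounded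
proof (intro allI impI)
  fix e :: real assume e: "e > 0"
  then obtain n where n: "norm (T n - L) < e / 2"
    using LIMSEQ_D[OF L, of "e / 2"] by auto
  obtain k where k: "finite k" "\<And>x. x \<in> cball 0 1 \<Longrightarrow> \<exists>a\<in>k. norm (T n x - a) < e / 2"
    using T[of n] e unfolding compact_operators_iff_totally_bounded by (metis half_gt_zero)
  have "\<exists>a\<in>k. norm (L x - a) < e" if x: "x \<in> cball 0 1" for x
  proof -
    obtain a where a: "a \<in> k" "norm (T n x - a) < e / 2" using k(2)[OF x] by blast
    have "norm (L x - T n x) < e / 2"
      using norm_blinfun_le_on_cball[OF x, of "T n - L"] n
      by (simp add: blinfun.diff_left norm_minus_commute)
    then have "norm (L x - a) < e"
      using norm_triangle_ineq[of "L x - T n x" "T n x - a"] a(2) by simp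
    then show ?thesis using a(1) by blast
  qed
  then show "\<exists>k. finite k \<and> (\<forall>x\<in>cball 0 1. \<exists>a\<in>k. norm (L x - a) < e)"
    using k(1) by blast
qed

text \<open>
  The image of the unit ball lies in an order interval up to a small error: take for \<open>u\<close> the sum of
  the absolute values of a finite net.
\<close>

lemma compact_operator_almost_order_bounded:
  fixes T :: "'a::real_normed_vector \<Rightarrow>\<^sub>L 'b::banach_lattice"
  assumes T: "T \<in> compact_operators" and e: "e > 0"
  obtains u where "0 \<le> u"
    "\<And>x. x \<in> cball 0 1 \<Longrightarrow> \<exists>v\<ge>0. norm v < e \<and> \<bar>T x\<bar> \<le> u + v"
proof -
  obtain k where k: "finite k" "\<And>x. x \<in> cball 0 1 \<Longrightarrow> \<exists>a\<in>k. norm (T x - a) < e"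
    using T e unfolding compact_operators_iff_totally_bounded by meson
  show ?thesis
  proof
    show "0 \<le> (\<Sum>a\<in>k. \<bar>a\<bar>)" by (simp add: sum_nonneg)
    fix x :: 'a assume "x \<in> cball 0 1"
    then obtain a where a: "a \<in> k" "norm (T x - a) < e" using k(2) by blast
    have "\<bar>T x\<bar> \<le> \<bar>a\<bar> + \<bar>T x - a\<bar>"
      using abs_triangle_ineq[of a "T x - a"] by simp
    also have "\<dots> \<le> (\<Sum>a\<in>k. \<bar>a\<bar>) + \<bar>T x - a\<bar>"
      using a(1) k(1) by (simp add: sum.remove[of k a] sum_nonneg)
    finally show "\<exists>v\<ge>0. norm v < e \<and> \<bar>T x\<bar> \<le> (\<Sum>a\<in>k. \<bar>a\<bar>) + v"
      using a(2) by (intro exI[of _ "\<bar>T x - a\<bar>"]) (simp add: norm_abs_eq)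
  qed
qed

section \<open>Increasing sequences between compact operators\<close>

lemma increasing_operators_Cauchy:
  fixes T :: "nat \<Rightarrow> ('a::banach_lattice \<Rightarrow>\<^sub>L 'b::banach_lattice)"
  assumes refl: "reflexive_space TYPE('a)" and ocn: "order_continuous_norm TYPE('b)"
    and mono: "\<And>n m. n \<le> m \<Longrightarrow> operator_le (T n) (T m)"
    and R: "R \<in> compact_operators" "\<And>n. operator_le R (T n)"
    and S: "S \<in> compact_operators" "\<And>n. operator_le (T n) S"
  shows "Cauchy T"
proof (rule ccontr)
  assume "\<not> Cauchy T"
  then obtain e where e: "e > 0" and far: "\<And>N. \<exists>m\<ge>N. e \<le> dist (T m) (T N)"
    unfolding Cauchy_altdef2 by (meson not_le)
  then obtain m where m: "\<And>N. N \<le> m N" "\<And>N. e \<le> norm (T (m N) - T N)"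
    unfolding dist_norm by metis
  define D where "D N = T (m N) - T N" for N
  have D_pos: "positive_operator (D N)" for N
    using mono[OF m(1)] by (simp add: operator_le_def D_def)
  have D_le: "D N x \<le> \<bar>S x\<bar> + \<bar>R x\<bar>" if x: "0 \<le> x" for N x
  proof -
    have "T (m N) x \<le> S x" "R x \<le> T N x"
      using positive_operatorD[OF _ x, of "S - T (m N)"] positive_operatorD[OF _ x, of "T N - R"]
        S(2)[of "m N"] R(2)[of N]
      by (simp_all add: operator_le_def blinfun.diff_left)
    then have "D N x \<le> S x - R x"
      by (simp add: D_def blinfun.diff_left diff_mono)
    also have "\<dots> \<le> \<bar>S x\<bar> + \<bar>R x\<bar>"
      using add_mono[OF abs_ge_self[of "S x"] abs_ge_minus_self[of "R x"]] by simp
    finally show ?thesis .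
  qed
  have "\<exists>x. 0 \<le> x \<and> norm x \<le> 1 \<and> e / 2 < norm (D N x)" for N
  proof (rule ccontr)
    assume "\<not> ?thesis"
    then have "norm (D N) \<le> e / 2"
      using e by (intro norm_positive_operator_le[OF D_pos]) (auto simp: not_less)
    then show False using m(2)[of N] e by (simp add: D_def)
  qed
  then obtain x where x: "\<And>N. 0 \<le> x N" "\<And>N. norm (x N) \<le> 1" "\<And>N. e / 2 < norm (D N (x N))"
    by metis
  obtain u1 where u1: "0 \<le> u1" "\<And>x. x \<in> cball 0 1 \<Longrightarrow> \<exists>v\<ge>0. norm v < e / 8 \<and> \<bar>S x\<bar> \<le> u1 + v"
    using compact_operator_almost_order_bounded[OF S(1), of "e / 8"] e by auto
  obtain u2 where u2: "0 \<le> u2" "\<And>x. x \<in> cball 0 1 \<Longrightarrow> \<exists>v\<ge>0. norm v < e / 8 \<and> \<bar>R x\<bar> \<le> u2 + v"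
    using compact_operator_almost_order_bounded[OF R(1), of "e / 8"] e by auto
  define u where "u = u1 + u2"
  define y where "y N = inf (D N (x N)) u" for N
  have y_le: "y N \<le> D N (x N)" for N by (simp add: y_def)
  have "\<exists>N. norm (y N) < e / 4"
  proof (rule order_bounded_weakly_null[OF ocn])
    show y0: "0 \<le> y N" for N
      using u1(1) u2(1) positive_operatorD[OF D_pos x(1)] by (simp add: y_def u_def)
    show "y N \<le> u" for N by (simp add: y_def)
    fix \<phi> :: "'b \<Rightarrow>\<^sub>L real" assume \<phi>: "positive_operator \<phi>"
    have "operator_le (\<phi> o\<^sub>L A) (\<phi> o\<^sub>L B)" if "operator_le A B" for A B :: "'a \<Rightarrow>\<^sub>L 'b"
      using that \<phi> by (simp add: operator_le_def positive_operator_def blinfun.diff_left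
          flip: blinfun.diff_right)
    then have "Cauchy (\<lambda>n. \<phi> o\<^sub>L T n)"
      using mono S(2) by (intro increasing_functionals_Cauchy[OF refl, of _ "\<phi> o\<^sub>L S"]) auto
    then have "(\<lambda>N. \<phi> o\<^sub>L D N) \<longlonglongrightarrow> 0"
    proof (intro LIMSEQ_I)
      fix r :: real assume "Cauchy (\<lambda>n. \<phi> o\<^sub>L T n)" "r > 0"
      then obtain M where M: "\<And>i j. i \<ge> M \<Longrightarrow> j \<ge> M \<Longrightarrow> norm ((\<phi> o\<^sub>L T i) - (\<phi> o\<^sub>L T j)) < r"
        using CauchyD by blast
      have "\<phi> o\<^sub>L D N = (\<phi> o\<^sub>L T (m N)) - (\<phi> o\<^sub>L T N)" for N
        by (rule blinfun_eqI) (simp add: D_def blinfun.diff_left blinfun.diff_right)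
      then have "norm ((\<phi> o\<^sub>L D N) - 0) < r" if "N \<ge> M" for N
        using M[of "m N" N] m(1)[of N] that by simp
      then show "\<exists>M. \<forall>N\<ge>M. norm ((\<phi> o\<^sub>L D N) - 0) < r" by blast
    qed
    then have "(\<lambda>N. norm (\<phi> o\<^sub>L D N)) \<longlonglongrightarrow> 0"
      by (rule tendsto_norm_zero)
    then show "(\<lambda>N. \<phi> (y N)) \<longlonglongrightarrow> 0"
    proof (rule Lim_null_comparison[rotated], intro always_eventually allI)
      fix N
      have "0 \<le> \<phi> (y N)" "\<phi> (y N) \<le> \<phi> (D N (x N))"
        using positive_operatorD[OF \<phi> y0] positive_operator_mono[OF \<phi> y_le] by auto
      moreover have "\<phi> (D N (x N)) \<le> norm (\<phi> o\<^sub>L D N)"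
        using norm_blinfun_le_on_cball[of "x N" "\<phi> o\<^sub>L D N"] x(2)[of N] by simp
      ultimately show "norm (\<phi> (y N)) \<le> norm (\<phi> o\<^sub>L D N)" by simp
    qed
  qed (use e in simp)
  then obtain N where N: "norm (y N) < e / 4" by blast
  obtain v1 v2 where v: "0 \<le> v1" "norm v1 < e / 8" "\<bar>S (x N)\<bar> \<le> u1 + v1"
      "0 \<le> v2" "norm v2 < e / 8" "\<bar>R (x N)\<bar> \<le> u2 + v2"
    using u1(2)[of "x N"] u2(2)[of "x N"] x(2)[of N] by auto
  have "D N (x N) \<le> \<bar>S (x N)\<bar> + \<bar>R (x N)\<bar>" by (rule D_le[OF x(1)])
  also have "\<dots> \<le> (u1 + v1) + (u2 + v2)" by (rule add_mono[OF v(3,6)])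
  \<comment> \<open>Splitting off the part above \<open>u\<close>: \<open>D N (x N)\<close> exceeds \<open>y N\<close> by at most \<open>v1 + v2\<close>.\<close>
  finally have "D N (x N) \<le> u + (v1 + v2)" by (simp add: u_def ac_simps)
  moreover have "D N (x N) \<le> D N (x N) + (v1 + v2)" using v(1,4) by simp
  ultimately have "D N (x N) \<le> y N + (v1 + v2)"
    by (simp add: y_def add_inf_distrib_right)
  then have "norm (D N (x N)) \<le> norm (y N + (v1 + v2))"
    by (rule norm_mono_pos[OF positive_operatorD[OF D_pos x(1)]])
  also have "\<dots> \<le> norm (y N) + (norm v1 + norm v2)"
    by (intro norm_triangle_le add_left_mono norm_triangle_ineq)
  finally show False using N v(2,5) x(3)[of N] by linarith
qed

theorem corollary4p7:
  fixes T :: "nat \<Rightarrow> ('a::banach_lattice \<Rightarrow>\<^sub>L 'b::banach_lattice)"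
  assumes "reflexive_space TYPE('a)"
    and "order_continuous_norm TYPE('b)"
    and "\<And>n. T n \<in> compact_operators"
    and "\<And>n m. n \<le> m \<Longrightarrow> operator_le (T n) (T m)"
    and "\<exists>R\<in>compact_operators. \<exists>S\<in>compact_operators.
           \<forall>n. operator_le R (T n) \<and> operator_le (T n) S"
  shows "\<exists>L\<in>compact_operators. T \<longlonglongrightarrow> L"
proof -
  obtain R S where "R \<in> compact_operators" "S \<in> compact_operators"
    and "\<And>n. operator_le R (T n)" "\<And>n. operator_le (T n) S"
    using assms(5) by blast
  then have "Cauchy T"
    using increasing_operators_Cauchy assms(1,2,4) by blast
  then obtain L where L: "T \<longlonglongrightarrow> L"
    using Cauchy_convergent convergent_def by blast
  then have "L \<in> compact_operators"
    by (rule compact_operators_LIMSEQ[OF assms(3)])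
  with L show ?thesis by blast
qed

end
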